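(* Consider the disturbance-free closed loop $x(k+1)=f(x(k),u(k),\mathbf{0}_m)$, $k\in\mathbb{N}_0$, with $u(k)$ generated by Algorithm A$_2$ (described in the context) with buffer size $\Lambda>2$. Suppose that: (1) there exist $\varphi_1,\varphi_2\in\mathscr{K}_\infty$, $V\colon\mathbb{R}^n\to\mathbb{R}_{\ge 0}$, $\kappa\colon\mathbb{R}^n\to\mathbb{R}^p$ and $\rho\in[0,1)$ such that for all $x\in\mathbb{R}^n$, $\varphi_1(|x|)\le V(x)\le\varphi_2(|x|)$ and $V(f(x,\kappa(x),\mathbf{0}_m))\le\rho V(x)$; (2) the process $\{N(k)\}_{k\in\mathbb{N}_0}$ is i.i.d. with $\Pr\{N(k)=l\}=p_l$, $l\in\{0,1,\dots,\Lambda\}$, and $p_0\in[0,1)$; (3) there exists $\alpha\in[1,1/p_0)$ such that $V(f(x,\mathbf{0}_p,\mathbf{0}_m))\le\alpha V(x)$ for all $x\in\mathbb{R}^n$, and $\mathbf{E}\{\varphi_2(|x(0)|)\}<\infty$. Define $$\sigma=\frac{1}{1-p_0\rho}\Big(\rho(1-p_0\alpha)+\frac{\alpha-\rho}{1-p_0}\sum_{l=1}^{\Lambda}p_l(p_0\rho)^l\Big).$$ If $p_0\alpha+(1-p_0)\sigma<1$, then the closed loop with state trajectory $\{x(k)\}_{k\in\mathbb{N}_0}$ is stochastically stable.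
   Context: Notation: $\mathbb{N}=\{1,2,\dots\}$, $\mathbb{N}_0=\mathbb{N}\cup\{0\}$; $\mathbf{0}_q$ is the zero vector in $\mathbb{R}^q$; $|\cdot|$ is the Euclidean norm; $1/p_0=\infty$ if $p_0=0$. A function $\varphi\colon\mathbb{R}_{\ge0}\to\mathbb{R}_{\ge0}$ is in $\mathscr{K}_\infty$ if it is continuous, zero at zero, strictly increasing and unbounded. Plant: $f\colon\mathbb{R}^n\times\mathbb{R}^p\times\mathbb{R}^m\to\mathbb{R}^n$ with $f(\mathbf{0}_n,\mathbf{0}_p,\mathbf{0}_m)=\mathbf{0}_n$; the initial state $x(0)$ is random. Stochastic stability: a system with state trajectory $\{x(k)\}_{k\in\mathbb{N}_0}$ is stochastically stable if $\sum_{k=0}^\infty\mathbf{E}\{\varphi(|x(k)|)\}<\infty$ for some $\varphi\in\mathscr{K}_\infty$. Algorithm A$_2$: $\Lambda\in\mathbb{N}$ is the buffer size, and $N(k)\in\{0,1,\dots,\Lambda\}$ is the random number of tentative controls that the processor can compute at step $k$. The tentative controls are computed by a fixed rule $\mu\colon\mathbb{R}^n\to\mathbb{R}^p$ satisfying $V(f(\chi,\mu(\chi),\mathbf{0}_m))\le\rho V(\chi)$ for all $\chi$ (for example $\mu=\kappa$): if $N(k)\ge1$, put $\chi_1=x(k)$ and, for $j=1,\dots,N(k)$, $u_j(k)=\mu(\chi_j)$, $\chi_{j+1}=f(\chi_j,u_j(k),\mathbf{0}_m)$. The buffer $b(k)=(b_1(k),\dots,b_\Lambda(k))$, with $b_j(k)\in\mathbb{R}^p$,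 is initialized by $b(-1)=0$. With the convention $b_{\Lambda+1}(k-1)=\mathbf{0}_p$, it obeys: $b_j(k)=u_j(k)$ for $1\le j\le N(k)$ and $b_j(k)=b_{j+1}(k-1)$ for $N(k)<j\le\Lambda$ (so if $N(k)=0$ the buffer is just shifted, and if $N(k)\geq 1$ only the first $N(k)$ entries of the shifted buffer are overwritten). The plant input is $u(k)=b_1(k)$. Standing conventions: it is assumed that $N(0)>0$ (probabilities and expectations are understood conditionally on this event); $x(0)$ is independent of $\{N(k)\}$; and $f,V,\kappa,\mu$ are Borel measurable. *)

theory Defs
  imports "HOL-Probability.Probability"
begin

(* Functions on the nonnegative reals are total functions on real that are only constrained on {0..}.
   Nonnegativity of the values on {0..} follows from phi 0 = 0 and strict monotonicity. *)
definition class_Kinf :: "(real \<Rightarrow> real) \<Rightarrow> bool" where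
  "class_Kinf \<phi> \<longleftrightarrow>
     continuous_on {0..} \<phi> \<and> \<phi> 0 = 0 \<and> strict_mono_on {0..} \<phi> \<and> \<not> bdd_above (\<phi> ` {0..})"

(* Expectations of nonnegative quantities are taken in [0, infinity]. *)
definition stochastically_stable ::
    "'w measure \<Rightarrow> (nat \<Rightarrow> 'w \<Rightarrow> 'a::real_normed_vector) \<Rightarrow> bool" where
  "stochastically_stable P X \<longleftrightarrow>
     (\<exists>\<phi>. class_Kinf \<phi> \<and> (\<Sum>k. \<integral>\<^sup>+\<omega>. ennreal (\<phi> (norm (X k \<omega>))) \<partial>P) < \<infinity>)"

context
  fixes f :: "(real^'n) \<times> (real^'p) \<times> (real^'m) \<Rightarrow> real^'n"
    and \<mu> :: "real^'n \<Rightarrow> real^'p"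
begin

(* The index is shifted: predicted_state x j is chi_(j+1), started from chi_1 = x. *)
primrec predicted_state :: "real^'n \<Rightarrow> nat \<Rightarrow> real^'n" where
  "predicted_state x 0 = x"
| "predicted_state x (Suc j) = f (predicted_state x j, \<mu> (predicted_state x j), 0)"

definition tentative_control :: "real^'n \<Rightarrow> nat \<Rightarrow> real^'p" where
  "tentative_control x j = \<mu> (predicted_state x (j - 1))"

(* A buffer of size L is a function whose entries are those with index in {1..L}; all other entries
   are kept at zero, which realises the convention that entry L + 1 of the old buffer is zero.
   The argument nc is the number of tentative controls computed at the current step. *)
definition buffer_update ::
    "nat \<Rightarrow> nat \<Rightarrow> real^'n \<Rightarrow> (nat \<Rightarrow> real^'p) \<Rightarrow> (nat \<Rightarrow> real^'p)" where
  "buffer_update L nc x b = (\<lambda>j.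
     if 1 \<le> j \<and> j \<le> nc then tentative_control x j
     else if nc < j \<and> j < L then b (j + 1)
     else 0)"

(* closed_loop L ns x0 k is the pair (x(k), b(k - 1)) along one sample path, where ns k is the
   number of tentative controls computed at step k. *)
primrec closed_loop ::
    "nat \<Rightarrow> (nat \<Rightarrow> nat) \<Rightarrow> real^'n \<Rightarrow> nat \<Rightarrow> (real^'n) \<times> (nat \<Rightarrow> real^'p)" where
  "closed_loop L ns x0 0 = (x0, \<lambda>_. 0)"
| "closed_loop L ns x0 (Suc k) =
     (let x = fst (closed_loop L ns x0 k);
          b = buffer_update L (ns k) x (snd (closed_loop L ns x0 k));
          u = b 1
      in (f (x, u, 0), b))"

definition state_trajectory :: "nat \<Rightarrow> (nat \<Rightarrow> nat) \<Rightarrow> real^'n \<Rightarrow> nat \<Rightarrow> real^'n" where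
  "state_trajectory L ns x0 k = fst (closed_loop L ns x0 k)"

end

end

theory Submission
  imports Defs
begin

text \<open>
  Without disturbances the predicted states are the true future states, so every control that was
  once computed and not yet overwritten is still the control that \<open>\<mu>\<close> would choose. Hence all the
  information in the buffer is one number, its charge: the number of leading entries that
  hold such controls, all later ones being zero. A step with charge \<open>c\<close> multiplies \<open>V\<close> by at
  most \<open>g c\<close>, which is \<open>\<alpha>\<close> for the empty buffer and \<open>\<rho>\<close> otherwise. Therefore
  \<open>V (x k) \<le> W k * V (x 0)\<close>, where the growth \<open>W k\<close> is the product of these factors and depends
  only on the computation counts (lemma \<open>Lyapunov_state_trajectory_le\<close>). As the initial state
  is independent of the counts, stability follows once the expectations of \<open>W k\<close> have a finite sum.

  The charge is a Markov chain: after \<open>c\<close> it becomes \<open>max l (c - 1)\<close> with probability \<open>p l\<close>. With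
  \<open>\<pi> = p 0\<close>, let
  \<open>G c = 1 + \<pi> g(c - 1) + \<pi>\<^sup>2 g(c - 1) g(c - 2) + \<dots>\<close>
  be the growth accumulated over a run of dropouts that starts at charge \<open>c\<close>, each term weighted by
  the probability that the run lasts that long; here \<open>c - i\<close> is zero for \<open>i \<ge> c\<close>, so \<open>\<pi> \<alpha> < 1\<close>
  makes the series converge. Then \<open>G c = 1 + \<pi> g(c - 1) G(c - 1)\<close>, and \<open>G\<close> is antimonotone
  because a fuller buffer can only help. If \<open>l\<close> controls arrive, the new charge is at least
  \<open>l \<ge> 1\<close>, so the factor times the new potential is at most \<open>\<rho> G l\<close>. Summing over
  all counts, the conditional expectation of \<open>g(c') G(c')\<close> for the next charge \<open>c'\<close> is at most
  \<open>G c - \<delta>\<close>, where \<open>\<delta> = 1 - \<Omega>\<close> and \<open>\<Omega> = (\<Sum>l=1..\<Lambda>. p l * \<rho> * G l)\<close>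
  (lemma \<open>potential_drift\<close>). Evaluating the geometric sums gives
  \<open>\<Omega> = (1 - \<pi>) \<sigma> / (1 - \<pi> \<alpha>)\<close> (lemma \<open>refill_sum\<close>), so the contraction condition says exactly
  that \<open>\<delta> > 0\<close>. Each step thus lowers the expectation of \<open>W k * G (c k)\<close> by at least \<open>\<delta>\<close> times
  the expectation of \<open>W k\<close>, and telescoping bounds the sum of the latter by \<open>G 0 / \<delta>\<close>
  (lemma \<open>sum_expectation_growth_le\<close>).

  All this is done under the unconditional measure, with the empty buffer as starting point.
  Conditioning on an event of probability \<open>1 - p 0 > 0\<close> raises the expectation of a nonnegative
  variable at most by the factor \<open>1 / (1 - p 0)\<close>.
\<close>

section \<open>The charge of the buffer\<close>

text \<open>
  The charge before step \<open>k\<close>, that is, the number of stored controls in \<open>b (k - 1)\<close>. The buffer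
  overwrites only its first \<open>ns k\<close> entries, hence the maximum; truncated subtraction keeps the
  charge of an empty buffer at zero.
\<close>
primrec charge :: "(nat \<Rightarrow> nat) \<Rightarrow> nat \<Rightarrow> nat" where
  "charge ns 0 = 0"
| "charge ns (Suc k) = max (ns k) (charge ns k - 1)"

definition gain :: "real \<Rightarrow> real \<Rightarrow> nat \<Rightarrow> real" where
  "gain \<rho> \<alpha> c = (if c = 0 then \<alpha> else \<rho>)"

definition growth :: "real \<Rightarrow> real \<Rightarrow> (nat \<Rightarrow> nat) \<Rightarrow> nat \<Rightarrow> real" where
  "growth \<rho> \<alpha> ns k = (\<Prod>i<k. gain \<rho> \<alpha> (charge ns (Suc i)))"

lemma growth_simps [simp]:
  "growth \<rho> \<alpha> ns 0 = 1"
  "growth \<rho> \<alpha> ns (Suc k) = growth \<rho> \<alpha> ns k * gain \<rho> \<alpha> (charge ns (Suc k))"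
  by (simp_all add: growth_def)

lemma charge_cong: "(\<And>i. i < k \<Longrightarrow> ns i = ns' i) \<Longrightarrow> charge ns k = charge ns' k"
  by (induction k) auto

lemma growth_cong: "(\<And>i. i < k \<Longrightarrow> ns i = ns' i) \<Longrightarrow> growth \<rho> \<alpha> ns k = growth \<rho> \<alpha> ns' k"
  unfolding growth_def by (intro prod.cong refl arg_cong[where f = "gain \<rho> \<alpha>"] charge_cong) auto

lemma growth_bounds:
  assumes "0 \<le> \<rho>" "\<rho> < 1" "1 \<le> \<alpha>"
  shows "0 \<le> growth \<rho> \<alpha> ns k" "growth \<rho> \<alpha> ns k \<le> \<alpha> ^ k"
proof -
  have g: "0 \<le> gain \<rho> \<alpha> c \<and> gain \<rho> \<alpha> c \<le> \<alpha>" for c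
    using assms by (auto simp: gain_def)
  show "0 \<le> growth \<rho> \<alpha> ns k"
    unfolding growth_def using g by (intro prod_nonneg) auto
  have "growth \<rho> \<alpha> ns k \<le> (\<Prod>i<k. \<alpha>)"
    unfolding growth_def using g by (intro prod_mono) auto
  then show "growth \<rho> \<alpha> ns k \<le> \<alpha> ^ k" by simp
qed

text \<open>
  Prediction is exact, so after a step that applies \<open>\<mu>\<close> the shifted controls are those that would
  be recomputed from the new state.
\<close>
lemma predicted_state_shift:
  "predicted_state f \<mu> (f (x, \<mu> x, 0)) j = predicted_state f \<mu> x (Suc j)"
  by (induction j) auto

lemma tentative_control_shift:
  "1 \<le> j \<Longrightarrow> tentative_control f \<mu> (f (x, \<mu> x, 0)) j = tentative_control f \<mu> x (Suc j)"
  by (cases j) (simp_all add: tentative_control_def predicted_state_shift)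

lemma charge_le: "(\<And>i. ns i \<le> L) \<Longrightarrow> charge ns k \<le> L"
  by (induction k) (auto simp: le_diff_conv intro: le_trans)

lemma buffer_update_charge:
  assumes "0 < L" "nc \<le> L" "d \<le> L"
    and "\<And>j. 1 \<le> j \<Longrightarrow> b (j + 1) = (if j \<le> d - 1 then tentative_control f \<mu> x j else 0)"
    and "1 \<le> j"
  shows "buffer_update f \<mu> L nc x b j = (if j \<le> max nc (d - 1) then tentative_control f \<mu> x j else 0)"
  using assms by (auto simp: buffer_update_def max_def)

text \<open>
  The invariant concerns the already shifted buffer, since its entries are the controls
  predicted from the current state. It survives a step in two different ways: if the new charge
  is positive, the applied control is \<open>\<mu> x\<close> and the predictions stay exact; if it is zero, the
  applied control is zero, but then no stored prediction is left to be invalidated.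
\<close>
lemma closed_loop_buffer:
  fixes f :: "(real^'n) \<times> (real^'p) \<times> (real^'m) \<Rightarrow> real^'n"
  assumes "0 < L" "\<And>i. ns i \<le> L" "1 \<le> j"
  shows "snd (closed_loop f \<mu> L ns x0 k) (j + 1) =
    (if j \<le> charge ns k - 1 then tentative_control f \<mu> (fst (closed_loop f \<mu> L ns x0 k)) j else 0)"
  using assms(3)
proof (induction k arbitrary: j)
  case 0
  then show ?case by simp
next
  case (Suc k)
  define x where "x = fst (closed_loop f \<mu> L ns x0 k)"
  define b where "b = buffer_update f \<mu> L (ns k) x (snd (closed_loop f \<mu> L ns x0 k))"
  have b: "b i = (if i \<le> charge ns (Suc k) then tentative_control f \<mu> x i else 0)" if "1 \<le> i" for i
    unfolding b_def charge.simps
    using assms(1,2) charge_le[of ns L k] Suc.IH that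
    by (intro buffer_update_charge) (auto simp: x_def)
  have step: "closed_loop f \<mu> L ns x0 (Suc k) = (f (x, b 1, 0), b)"
    by (simp add: Let_def x_def b_def)
  show ?case
  proof (cases "charge ns (Suc k) = 0")
    case True
    then show ?thesis using step b[of "j + 1"] Suc.prems by simp
  next
    case False
    then have "b 1 = \<mu> x"
      using b[of 1] by (simp add: tentative_control_def Suc_le_eq del: charge.simps)
    then show ?thesis
      using step b[of "j + 1"] Suc.prems tentative_control_shift[of j f \<mu> x]
      by (auto simp del: charge.simps closed_loop.simps)
  qed
qed

lemma state_trajectory_Suc:
  fixes f :: "(real^'n) \<times> (real^'p) \<times> (real^'m) \<Rightarrow> real^'n"
  assumes "0 < L" "\<And>i. ns i \<le> L"
  shows "state_trajectory f \<mu> L ns x0 (Suc k) =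
    (let x = state_trajectory f \<mu> L ns x0 k
     in f (x, if charge ns (Suc k) = 0 then 0 else \<mu> x, 0))"
proof -
  define x where "x = fst (closed_loop f \<mu> L ns x0 k)"
  have "buffer_update f \<mu> L (ns k) x (snd (closed_loop f \<mu> L ns x0 k)) 1 =
      (if 1 \<le> max (ns k) (charge ns k - 1) then tentative_control f \<mu> x 1 else 0)"
    using assms charge_le[of ns L k] closed_loop_buffer[where L = L and ns = ns and f = f and \<mu> = \<mu> and ?x0.0 = x0 and k = k]
    by (intro buffer_update_charge) (auto simp: x_def)
  then show ?thesis
    by (auto simp: state_trajectory_def Let_def x_def[symmetric] tentative_control_def)
qed

lemma Lyapunov_state_trajectory_le:
  fixes f :: "(real^'n) \<times> (real^'p) \<times> (real^'m) \<Rightarrow> real^'n"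
  assumes "0 < L" "\<And>i. ns i \<le> L"
    and "0 \<le> \<rho>" "0 \<le> \<alpha>"
    and V_\<mu>: "\<And>x. V (f (x, \<mu> x, 0)) \<le> \<rho> * V x"
    and V_open: "\<And>x. V (f (x, 0, 0)) \<le> \<alpha> * V x"
  shows "V (state_trajectory f \<mu> L ns x0 k) \<le> growth \<rho> \<alpha> ns k * V x0"
proof (induction k)
  case 0
  then show ?case by (simp add: state_trajectory_def)
next
  case (Suc k)
  let ?x = "state_trajectory f \<mu> L ns x0 k" and ?g = "gain \<rho> \<alpha> (charge ns (Suc k))"
  have "V (state_trajectory f \<mu> L ns x0 (Suc k)) \<le> ?g * V ?x"
    using state_trajectory_Suc[where ns = ns, OF assms(1,2), of f \<mu> x0 k] V_\<mu>[of ?x] V_open[of ?x]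
    by (auto simp: Let_def gain_def)
  also have "\<dots> \<le> ?g * (growth \<rho> \<alpha> ns k * V x0)"
    using Suc.IH assms(3,4) by (intro mult_left_mono) (auto simp: gain_def)
  finally show ?case by (simp add: mult_ac del: charge.simps)
qed

section \<open>A potential for the charge\<close>

text \<open>
  The closed form of the sum over \<open>j\<close> of
  \<open>\<pi>^j * (\<Prod>i=1..j. gain \<rho> \<alpha> (c - i))\<close>: in the first \<open>c - 1\<close> factors the buffer still
  delivers controls, afterwards it is empty. Truncated subtraction makes the values at \<open>0\<close>
  and \<open>1\<close> agree, as they should: in both cases the next dropout finds nothing left.
\<close>
definition potential :: "real \<Rightarrow> real \<Rightarrow> real \<Rightarrow> nat \<Rightarrow> real" where
  "potential \<pi> \<rho> \<alpha> c =
     (1 - (\<pi> * \<rho>) ^ (c - 1)) / (1 - \<pi> * \<rho>) + (\<pi> * \<rho>) ^ (c - 1) / (1 - \<pi> * \<alpha>)"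

text \<open>Here \<open>\<pi>\<close> is the dropout probability, and \<open>\<pi> * \<alpha> < 1\<close> makes dropout runs summable.\<close>
locale dropout_parameters =
  fixes \<pi> \<rho> \<alpha> :: real
  assumes \<pi>: "0 \<le> \<pi>" "\<pi> < 1" and \<rho>: "0 \<le> \<rho>" "\<rho> < 1" and \<alpha>: "1 \<le> \<alpha>" "\<pi> * \<alpha> < 1"
begin

abbreviation "g \<equiv> gain \<rho> \<alpha>"
abbreviation "G \<equiv> potential \<pi> \<rho> \<alpha>"

lemma dropout_products: "0 \<le> \<pi> * \<rho>" "\<pi> * \<rho> < 1" "\<pi> * \<rho> \<le> \<pi> * \<alpha>"
proof -
  show "0 \<le> \<pi> * \<rho>" using \<pi> \<rho> by simp
  show "\<pi> * \<rho> \<le> \<pi> * \<alpha>" using \<pi> \<rho> \<alpha> by (intro mult_left_mono) auto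
  then show "\<pi> * \<rho> < 1" using \<alpha> by simp
qed

lemma potential_eq:
  "G c = 1 / (1 - \<pi> * \<rho>) + (\<pi> * \<rho>) ^ (c - 1) * (1 / (1 - \<pi> * \<alpha>) - 1 / (1 - \<pi> * \<rho>))"
  by (simp add: potential_def diff_divide_distrib right_diff_distrib)

lemma potential_coeff_nonneg: "0 \<le> 1 / (1 - \<pi> * \<alpha>) - 1 / (1 - \<pi> * \<rho>)"
  using dropout_products \<alpha> by (simp add: frac_le)

lemma potential_antimono: "c \<le> d \<Longrightarrow> G d \<le> G c"
  unfolding potential_eq using dropout_products potential_coeff_nonneg
  by (intro add_left_mono mult_right_mono power_decreasing) auto

lemma potential_ge_0: "0 \<le> G c"
  unfolding potential_eq using dropout_products potential_coeff_nonneg by (intro add_nonneg_nonneg mult_nonneg_nonneg) auto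

lemma potential_le: "G c \<le> G 0"
  by (rule potential_antimono) simp

text \<open>Splitting off the empty run leaves the sum for charge \<open>c - 1\<close>, weighted by the first dropout.\<close>
lemma potential_shift: "G c = 1 + \<pi> * (g (c - 1) * G (c - 1))"
proof (cases "c \<le> 1")
  case True
  then have c: "c - 1 = 0" by simp
  then have G: "G c = 1 / (1 - \<pi> * \<alpha>)" "G (c - 1) = 1 / (1 - \<pi> * \<alpha>)"
    by (simp_all add: potential_def)
  show ?thesis unfolding G using \<alpha> c by (simp add: gain_def field_simps)
next
  case False
  then obtain m where c: "c = Suc (Suc m)"
    by (metis One_nat_def le_Suc_eq le0 not0_implies_Suc)
  have "1 + \<pi> * \<rho> * (1 / (1 - \<pi> * \<rho>)) = 1 / (1 - \<pi> * \<rho>)"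
    using dropout_products by (simp add: field_simps)
  then show ?thesis unfolding potential_eq c by (simp add: gain_def algebra_simps)
qed

text \<open>
  Leftover controls beyond the \<open>l\<close> new ones can be forgotten, because they only lower the potential.
\<close>
lemma refill_le:
  assumes "1 \<le> l"
  shows "g (max l d) * G (max l d) \<le> \<rho> * G l"
  using assms \<rho> potential_antimono[of l "max l d"]
  by (auto simp: gain_def intro!: mult_left_mono)

text \<open>
  Dividing by the probability \<open>1 - \<pi>\<close> of a refill and multiplying by the probability \<open>1 - \<pi>\<close> that
  a dropout run ends, one recognises the left-hand side as the expected growth between two
  consecutive refills when older controls are discarded. This explains the shape of \<open>\<sigma>\<close>.
\<close>
lemma refill_sum:
  fixes p :: "nat \<Rightarrow> real"
  assumes p: "(\<Sum>l=1..L. p l) = 1 - \<pi>"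
    and \<sigma>: "\<sigma> = 1 / (1 - \<pi> * \<rho>) *
               (\<rho> * (1 - \<pi> * \<alpha>) + (\<alpha> - \<rho>) / (1 - \<pi>) * (\<Sum>l=1..L. p l * (\<pi> * \<rho>) ^ l))"
  shows "(\<Sum>l=1..L. p l * (\<rho> * G l)) = (1 - \<pi>) * \<sigma> / (1 - \<pi> * \<alpha>)"
proof -
  define S where "S = (\<Sum>l=1..L. p l * (\<pi> * \<rho>) ^ l)"
  have nz: "1 - \<pi> * \<rho> \<noteq> 0" "1 - \<pi> * \<alpha> \<noteq> 0" "1 - \<pi> \<noteq> 0"
    using dropout_products \<alpha> \<pi> by auto
  define D where "D = (\<alpha> - \<rho>) / ((1 - \<pi> * \<alpha>) * (1 - \<pi> * \<rho>))"
  have D: "1 / (1 - \<pi> * \<alpha>) - 1 / (1 - \<pi> * \<rho>) = \<pi> * D"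
    using nz by (simp add: D_def divide_simps) (simp add: algebra_simps)
  have "p l * (\<rho> * G l) = \<rho> / (1 - \<pi> * \<rho>) * p l + D * (p l * (\<pi> * \<rho>) ^ l)" if "l \<in> {1..L}" for l
  proof -
    \<comment> \<open>the missing power of \<open>\<pi> * \<rho>\<close> in the potential comes from \<open>\<rho>\<close> in front of it and \<open>\<pi>\<close> in front of \<open>D\<close>\<close>
    have "(\<pi> * \<rho>) ^ l = \<pi> * \<rho> * (\<pi> * \<rho>) ^ (l - 1)"
      using that by (cases l) auto
    then show ?thesis unfolding potential_eq D by (simp add: algebra_simps)
  qed
  then have "(\<Sum>l=1..L. p l * (\<rho> * G l)) = \<rho> / (1 - \<pi> * \<rho>) * (1 - \<pi>) + D * S"
    unfolding S_def p[symmetric] by (simp add: sum.distrib sum_distrib_left)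
  also have "\<dots> = (1 - \<pi>) * \<sigma> / (1 - \<pi> * \<alpha>)"
  proof -
    have "\<rho> / c * a + e / (b * c) * S = a * (1 / c * (\<rho> * b + e / a * S)) / b"
      if "a \<noteq> 0" "b \<noteq> 0" "c \<noteq> 0" for a b c e :: real
      using that by (simp add: field_simps)
    then show ?thesis unfolding \<sigma> D_def S_def[symmetric] using nz by blast
  qed
  finally show ?thesis .
qed

text \<open>
  By the previous recursion the dropout term is the potential minus \<open>1\<close>; the refills add back at most the
  expected growth between refills.
\<close>
lemma potential_drift:
  fixes p :: "nat \<Rightarrow> real"
  assumes p: "p 0 = \<pi>" "\<And>l. l \<le> L \<Longrightarrow> 0 \<le> p l"
  shows "(\<Sum>l\<le>L. p l * (g (max l (c - 1)) * G (max l (c - 1)))) \<le> G c - (1 - (\<Sum>l=1..L. p l * (\<rho> * G l)))"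
proof -
  have "{..L} = insert 0 {1..L}" by auto
  then have "(\<Sum>l\<le>L. p l * (g (max l (c - 1)) * G (max l (c - 1)))) =
      \<pi> * (g (c - 1) * G (c - 1)) + (\<Sum>l=1..L. p l * (g (max l (c - 1)) * G (max l (c - 1))))"
    by (simp add: p)
  also have "\<dots> \<le> (G c - 1) + (\<Sum>l=1..L. p l * (\<rho> * G l))"
    using p(2) refill_le potential_shift[of c]
    by (intro add_mono sum_mono mult_left_mono) auto
  finally show ?thesis by simp
qed

end

section \<open>Expected growth under independent computation counts\<close>

text \<open>
  A function of finitely many natural-number coordinates lives on a countable discrete space, where
  everything is measurable. This covers growth and charge without looking into their definitions.
\<close>
lemma measurable_finitely_dependent:
  fixes F :: "(nat \<Rightarrow> nat) \<Rightarrow> 'b"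
  assumes F: "\<And>ns ns'. (\<And>i. i < k \<Longrightarrow> ns i = ns' i) \<Longrightarrow> F ns = F ns'"
    and "space K = UNIV" and "{..<k} \<subseteq> I"
  shows "F \<in> measurable (Pi\<^sub>M I (\<lambda>_. count_space UNIV)) K"
proof -
  have "(\<lambda>ns. restrict ns {..<k}) \<in> measurable (Pi\<^sub>M I (\<lambda>_. count_space UNIV)) (Pi\<^sub>M {..<k} (\<lambda>_. count_space (UNIV :: nat set)))"
    using assms(3) by (intro measurable_restrict_subset)
  moreover have "F \<in> measurable (Pi\<^sub>M {..<k} (\<lambda>_. count_space (UNIV :: nat set))) K"
    by (subst count_space_PiM_finite) (auto simp: assms(2))
  ultimately have "(\<lambda>ns. F (restrict ns {..<k})) \<in> measurable (Pi\<^sub>M I (\<lambda>_. count_space UNIV)) K"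
    by (rule measurable_compose)
  moreover have "F (restrict ns {..<k}) = F ns" for ns
    by (rule F) auto
  ultimately show ?thesis by simp
qed

context prob_space
begin

text \<open>
  This replaces conditioning on the past: the count at step \<open>k\<close> is independent of the earlier ones,
  so it can be averaged out by its law while the past is kept. Boundedness only provides integrability.
\<close>
lemma expectation_fresh:
  fixes N :: "nat \<Rightarrow> 'a \<Rightarrow> nat" and \<Phi> :: "(nat \<Rightarrow> nat) \<Rightarrow> nat \<Rightarrow> real"
  assumes N: "indep_vars (\<lambda>_. count_space UNIV) N UNIV"
    and N_range: "\<And>\<omega>. \<omega> \<in> space M \<Longrightarrow> N k \<omega> \<le> L"
    and cong: "\<And>ns ns' l. (\<And>i. i < k \<Longrightarrow> ns i = ns' i) \<Longrightarrow> \<Phi> ns l = \<Phi> ns' l"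
    and bound: "\<And>ns l. \<bar>\<Phi> ns l\<bar> \<le> B"
  shows "expectation (\<lambda>\<omega>. \<Phi> (\<lambda>i. N i \<omega>) (N k \<omega>)) =
    (\<Sum>l\<le>L. prob {\<omega> \<in> space M. N k \<omega> = l} * expectation (\<lambda>\<omega>. \<Phi> (\<lambda>i. N i \<omega>) l))"
proof -
  have N_meas [measurable]: "N i \<in> measurable M (count_space UNIV)" for i
    using N by (simp add: indep_vars_def)
  have "(\<lambda>\<omega> i. N i \<omega>) \<in> measurable M (Pi\<^sub>M UNIV (\<lambda>_. count_space UNIV))"
    by (rule measurable_PiM_single') auto
  then have \<Phi>_meas [measurable]: "(\<lambda>\<omega>. \<Phi> (\<lambda>i. N i \<omega>) l) \<in> borel_measurable M" for l
    by (rule measurable_compose[OF _ measurable_finitely_dependent[where k = k]]) (auto intro: cong)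
  have \<Phi>_int: "integrable M (\<lambda>\<omega>. \<Phi> (\<lambda>i. N i \<omega>) l)" for l
    by (rule integrable_const_bound[where B = B]) (auto simp: bound)
  define I where "I l \<omega> = (indicator {l} (N k \<omega>) :: real)" for l \<omega>
  have I_int: "integrable M (I l)" for l
    unfolding I_def
    by (rule integrable_const_bound[where B = 1]) (auto intro!: measurable_compose[OF N_meas])
  have indep: "indep_var borel (\<lambda>\<omega>. \<Phi> (\<lambda>i. N i \<omega>) l) borel (I l)" for l
  proof -
    let ?past = "\<lambda>\<omega>. restrict (\<lambda>i. N i \<omega>) {..<k}" and ?now = "\<lambda>\<omega>. restrict (\<lambda>i. N i \<omega>) {k}"
    have "indep_var (Pi\<^sub>M {..<k} (\<lambda>_. count_space UNIV)) ?past (Pi\<^sub>M {k} (\<lambda>_. count_space UNIV)) ?now"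
      by (rule indep_var_restrict[OF N]) auto
    then have "indep_var borel ((\<lambda>ns. \<Phi> ns l) \<circ> ?past) borel ((\<lambda>ns. indicator {l} (ns k) :: real) \<circ> ?now)"
    proof (rule indep_var_compose)
      show "(\<lambda>ns. \<Phi> ns l) \<in> borel_measurable (Pi\<^sub>M {..<k} (\<lambda>_. count_space UNIV))"
        by (rule measurable_finitely_dependent[where k = k]) (auto intro: cong)
      show "(\<lambda>ns. indicator {l} (ns k) :: real) \<in> borel_measurable (Pi\<^sub>M {k} (\<lambda>_. count_space UNIV))"
        by (rule measurable_compose[OF measurable_component_singleton]) auto
    qed
    moreover have "(\<lambda>ns. \<Phi> ns l) \<circ> ?past = (\<lambda>\<omega>. \<Phi> (\<lambda>i. N i \<omega>) l)"
      by (auto simp: comp_def intro!: ext cong)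
    ultimately show ?thesis
      by (simp add: comp_def I_def[abs_def])
  qed
  have I_expectation: "expectation (I l) = prob {\<omega> \<in> space M. N k \<omega> = l}" for l
  proof -
    have "expectation (I l) = expectation (indicator {\<omega> \<in> space M. N k \<omega> = l})"
      unfolding I_def by (intro Bochner_Integration.integral_cong) (auto simp: indicator_def)
    then show ?thesis by simp
  qed
  have "expectation (\<lambda>\<omega>. \<Phi> (\<lambda>i. N i \<omega>) (N k \<omega>)) = expectation (\<lambda>\<omega>. \<Sum>l\<le>L. \<Phi> (\<lambda>i. N i \<omega>) l * I l \<omega>)"
  proof (rule Bochner_Integration.integral_cong)
    fix \<omega> assume "\<omega> \<in> space M"
    then have "(\<Sum>l\<le>L. \<Phi> (\<lambda>i. N i \<omega>) l * I l \<omega>) = (\<Sum>l\<in>{N k \<omega>}. \<Phi> (\<lambda>i. N i \<omega>) l)"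
      using N_range by (intro sum.mono_neutral_cong_right) (auto simp: I_def)
    then show "\<Phi> (\<lambda>i. N i \<omega>) (N k \<omega>) = (\<Sum>l\<le>L. \<Phi> (\<lambda>i. N i \<omega>) l * I l \<omega>)" by simp
  qed simp
  also have "\<dots> = (\<Sum>l\<le>L. expectation (\<lambda>\<omega>. \<Phi> (\<lambda>i. N i \<omega>) l * I l \<omega>))"
    by (intro Bochner_Integration.integral_sum indep_var_integrable indep \<Phi>_int I_int)
  also have "\<dots> = (\<Sum>l\<le>L. expectation (\<lambda>\<omega>. \<Phi> (\<lambda>i. N i \<omega>) l) * expectation (I l))"
    by (intro sum.cong refl indep_var_lebesgue_integral indep \<Phi>_int I_int)
  finally show ?thesis by (simp add: I_expectation mult_ac)
qed

text \<open>
  The constant \<open>indep_var\<close> requires both variables to take values in the same type. Here \<open>X\<close> and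
  \<open>Y\<close> may differ in type, as a state and a path of counts do; only their images under \<open>u\<close> and
  \<open>v\<close> are comparable.
\<close>
lemma indep_var_of_indep_vimage_algebras:
  assumes indep: "indep_set (sets (vimage_algebra (space M) X S)) (sets (vimage_algebra (space M) Y T))"
    and [measurable]: "X \<in> measurable M S" "Y \<in> measurable M T" "u \<in> measurable S R" "v \<in> measurable T R'"
  shows "indep_var R (\<lambda>\<omega>. u (X \<omega>)) R' (\<lambda>\<omega>. v (Y \<omega>))"
proof -
  have sub: "sigma_sets (space M) {(\<lambda>\<omega>. u (X \<omega>)) -` A \<inter> space M |A. A \<in> sets R}
      \<subseteq> sets (vimage_algebra (space M) X S)"
    if [measurable]: "X \<in> measurable M S" "u \<in> measurable S R" for X S u and R :: "'d measure"
  proof -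
    have "(\<lambda>\<omega>. u (X \<omega>)) \<in> measurable (vimage_algebra (space M) X S) R"
      by (rule measurable_compose[OF measurable_vimage_algebra1 that(2)]) (use measurable_space[OF that(1)] in auto)
    from measurable_sets[OF this]
    have "{(\<lambda>\<omega>. u (X \<omega>)) -` A \<inter> space M |A. A \<in> sets R} \<subseteq> sets (vimage_algebra (space M) X S)"
      by auto
    from sets.sigma_sets_subset[OF this] show ?thesis by simp
  qed
  show ?thesis
    unfolding indep_var_eq
  proof (intro conjI)
    show "indep_set (sigma_sets (space M) {(\<lambda>\<omega>. u (X \<omega>)) -` A \<inter> space M |A. A \<in> sets R})
        (sigma_sets (space M) {(\<lambda>\<omega>. v (Y \<omega>)) -` A \<inter> space M |A. A \<in> sets R'})"
      using indep sub[of X S u R] sub[of Y T v R'] assms(2-) unfolding indep_set_def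
      by (elim indep_sets_mono_sets) (simp split: bool.split)
  qed measurable
qed

lemma nn_integral_indep_var_mult:
  fixes X Y :: "'a \<Rightarrow> ennreal"
  assumes "indep_var borel X borel Y"
  shows "(\<integral>\<^sup>+\<omega>. X \<omega> * Y \<omega> \<partial>M) = (\<integral>\<^sup>+\<omega>. X \<omega> \<partial>M) * (\<integral>\<^sup>+\<omega>. Y \<omega> \<partial>M)"
proof -
  have "indep_vars (\<lambda>_. borel) (case_bool X Y) UNIV"
    using assms unfolding indep_var_def by (rule back_subst[where P = "\<lambda>B. indep_vars B _ _"]) (auto split: bool.split)
  from indep_vars_nn_integral[OF _ this] show ?thesis
    by (simp add: UNIV_bool mult_ac)
qed

text \<open>
  A telescoping argument of Foster-Lyapunov type. The crude bound \<open>\<alpha> ^ k\<close> on the growth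
  makes all expectations finite, so that the drift inequality may be subtracted.
\<close>
lemma sum_expectation_growth_le:
  fixes N :: "nat \<Rightarrow> 'a \<Rightarrow> nat" and p :: "nat \<Rightarrow> real"
  assumes par: "dropout_parameters (p 0) \<rho> \<alpha>"
    and N: "indep_vars (\<lambda>_. count_space UNIV) N UNIV"
    and N_range: "\<And>k \<omega>. \<omega> \<in> space M \<Longrightarrow> N k \<omega> \<le> L"
    and law: "\<And>k l. l \<le> L \<Longrightarrow> prob {\<omega> \<in> space M. N k \<omega> = l} = p l"
    and \<delta>: "\<delta> = 1 - (\<Sum>l=1..L. p l * (\<rho> * potential (p 0) \<rho> \<alpha> l))" "0 < \<delta>"
  shows "(\<Sum>k<n. expectation (\<lambda>\<omega>. growth \<rho> \<alpha> (\<lambda>i. N i \<omega>) k)) \<le> potential (p 0) \<rho> \<alpha> 0 / \<delta>"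
proof -
  interpret dropout_parameters "p 0" \<rho> \<alpha> by (rule par)
  have N_meas [measurable]: "N i \<in> measurable M (count_space UNIV)" for i
    using N by (simp add: indep_vars_def)
  have N_path: "(\<lambda>\<omega> i. N i \<omega>) \<in> measurable M (Pi\<^sub>M UNIV (\<lambda>_. count_space UNIV))"
    by (rule measurable_PiM_single') auto
  define W where "W = growth \<rho> \<alpha>"
  note W_bounds = growth_bounds[OF \<rho> \<alpha>(1), folded W_def]
  have W_cong: "W ns k = W ns' k" if "\<And>i. i < k \<Longrightarrow> ns i = ns' i" for ns ns' k
    unfolding W_def using that by (rule growth_cong)
  have g_bounds: "0 \<le> g c" "g c \<le> \<alpha>" for c
    using \<rho> \<alpha>(1) by (auto simp: gain_def)
  define a where "a k = expectation (\<lambda>\<omega>. W (\<lambda>i. N i \<omega>) k * G (charge (\<lambda>i. N i \<omega>) k))" for k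
  define w where "w k = expectation (\<lambda>\<omega>. W (\<lambda>i. N i \<omega>) k)" for k
  have p_nonneg: "0 \<le> p l" if "l \<le> L" for l
    using law[OF that, of 0] measure_nonneg by metis
  have bound: "\<bar>W ns k * h\<bar> \<le> \<alpha> ^ k * C" if "\<bar>h\<bar> \<le> C" for ns k h C
    using W_bounds[of ns k] that by (auto simp: abs_mult intro!: mult_mono)
  have int: "integrable M (\<lambda>\<omega>. W (\<lambda>i. N i \<omega>) k * h (charge (\<lambda>i. N i \<omega>) k))"
    if "\<And>c. \<bar>h c\<bar> \<le> C" for h :: "nat \<Rightarrow> real" and k C
  proof (rule integrable_const_bound[where B = "\<alpha> ^ k * C"])
    show "(\<lambda>\<omega>. W (\<lambda>i. N i \<omega>) k * h (charge (\<lambda>i. N i \<omega>) k)) \<in> borel_measurable M"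
    proof (rule measurable_compose[OF N_path measurable_finitely_dependent[where k = k]])
      show "W ns k * h (charge ns k) = W ns' k * h (charge ns' k)"
        if "\<And>i. i < k \<Longrightarrow> ns i = ns' i" for ns ns'
        using W_cong[of k ns ns', OF that] charge_cong[of k ns ns', OF that] by simp
    qed auto
  qed (use bound that in auto)
  have W_int: "integrable M (\<lambda>\<omega>. W (\<lambda>i. N i \<omega>) k)" for k
    using int[of "\<lambda>_. 1" 1 k] by simp
  have WG_int: "integrable M (\<lambda>\<omega>. W (\<lambda>i. N i \<omega>) k * G (charge (\<lambda>i. N i \<omega>) k))" for k
    using potential_le potential_ge_0 by (intro int[of G "G 0"]) auto
  have drift: "a (Suc k) \<le> a k - \<delta> * w k" for k
  proof -
    define \<Phi> where "\<Phi> ns l = W ns k * (g (max l (charge ns k - 1)) * G (max l (charge ns k - 1)))" for ns l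
    have gG: "\<bar>g c * G c\<bar> \<le> \<alpha> * G 0" for c
      using g_bounds[of c] potential_le[of c] potential_ge_0[of c] by (auto simp: abs_mult intro!: mult_mono)
    have \<Phi>_int: "integrable M (\<lambda>\<omega>. \<Phi> (\<lambda>i. N i \<omega>) l)" for l
      unfolding \<Phi>_def by (rule int[of "\<lambda>c. g (max l (c - 1)) * G (max l (c - 1))"]) (rule gG)
    have "a (Suc k) = expectation (\<lambda>\<omega>. \<Phi> (\<lambda>i. N i \<omega>) (N k \<omega>))"
      by (simp add: a_def \<Phi>_def W_def mult_ac)
    also have "\<dots> = (\<Sum>l\<le>L. p l * expectation (\<lambda>\<omega>. \<Phi> (\<lambda>i. N i \<omega>) l))"
    proof (subst expectation_fresh[where B = "\<alpha> ^ k * (\<alpha> * G 0)" and L = L])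
      show "\<Phi> ns l = \<Phi> ns' l" if "\<And>i. i < k \<Longrightarrow> ns i = ns' i" for ns ns' l
        unfolding \<Phi>_def using W_cong[of k ns ns', OF that] charge_cong[of k ns ns', OF that] by simp
      show "\<bar>\<Phi> ns l\<bar> \<le> \<alpha> ^ k * (\<alpha> * G 0)" for ns l
        unfolding \<Phi>_def by (rule bound[OF gG])
    qed (use N N_range law in auto)
    also have "\<dots> = expectation (\<lambda>\<omega>. \<Sum>l\<le>L. p l * \<Phi> (\<lambda>i. N i \<omega>) l)"
      using \<Phi>_int by (simp add: Bochner_Integration.integral_sum)
    also have "\<dots> \<le> expectation (\<lambda>\<omega>. W (\<lambda>i. N i \<omega>) k * G (charge (\<lambda>i. N i \<omega>) k) - \<delta> * W (\<lambda>i. N i \<omega>) k)"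
    proof (rule integral_mono)
      show "integrable M (\<lambda>\<omega>. \<Sum>l\<le>L. p l * \<Phi> (\<lambda>i. N i \<omega>) l)"
        using \<Phi>_int by (intro Bochner_Integration.integrable_sum integrable_mult_right)
      show "integrable M (\<lambda>\<omega>. W (\<lambda>i. N i \<omega>) k * G (charge (\<lambda>i. N i \<omega>) k) - \<delta> * W (\<lambda>i. N i \<omega>) k)"
        using W_int WG_int by (intro Bochner_Integration.integrable_diff integrable_mult_right)
      fix \<omega>
      let ?ns = "\<lambda>i. N i \<omega>"
      have "(\<Sum>l\<le>L. p l * \<Phi> ?ns l) =
          W ?ns k * (\<Sum>l\<le>L. p l * (g (max l (charge ?ns k - 1)) * G (max l (charge ?ns k - 1))))"
        by (simp add: \<Phi>_def sum_distrib_left mult_ac)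
      also have "\<dots> \<le> W ?ns k * (G (charge ?ns k) - \<delta>)"
        unfolding \<delta>(1) using p_nonneg W_bounds by (intro mult_left_mono potential_drift) auto
      finally show "(\<Sum>l\<le>L. p l * \<Phi> ?ns l) \<le> W ?ns k * G (charge ?ns k) - \<delta> * W ?ns k"
        by (simp add: algebra_simps)
    qed
    also have "\<dots> = a k - \<delta> * w k"
      unfolding a_def w_def
      using W_int WG_int by (simp add: Bochner_Integration.integral_diff)
    finally show ?thesis .
  qed
  have "\<delta> * (\<Sum>k<n. w k) \<le> a 0 - a n" for n
  proof (induction n)
    case (Suc n)
    then show ?case using drift[of n] by (simp add: distrib_left)
  qed simp
  moreover have "0 \<le> a n"
    unfolding a_def using W_bounds potential_ge_0 by (intro integral_nonneg_AE) auto
  moreover have "a 0 = G 0" by (simp add: a_def W_def prob_space)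
  ultimately have "\<delta> * (\<Sum>k<n. w k) \<le> G 0"
    by (metis diff_ge_0_iff_ge diff_le_eq le_add_same_cancel1 order_trans)
  then show ?thesis using \<delta>(2) by (simp add: w_def W_def field_simps)
qed

end
theorem theorem3:
  fixes M :: "'w measure"
    and f :: "(real^'n) \<times> (real^'p) \<times> (real^'m) \<Rightarrow> real^'n"
    and V :: "real^'n \<Rightarrow> real"
    and \<kappa> \<mu> :: "real^'n \<Rightarrow> real^'p"
    and \<phi>1 \<phi>2 :: "real \<Rightarrow> real"
    and \<rho> \<alpha> \<sigma> :: real
    and p :: "nat \<Rightarrow> real"
    and \<Lambda> :: nat
    and N :: "nat \<Rightarrow> 'w \<Rightarrow> nat"
    and x0 :: "'w \<Rightarrow> real^'n"
    and P :: "'w measure"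
  assumes M: "prob_space M"
    and f_meas: "f \<in> borel_measurable borel"
    and V_meas: "V \<in> borel_measurable borel"
    and \<kappa>_meas: "\<kappa> \<in> borel_measurable borel"
    and \<mu>_meas: "\<mu> \<in> borel_measurable borel"
    and f_zero: "f (0, 0, 0) = 0"
    and buffer_size: "\<Lambda> > 2"
    and Kinf: "class_Kinf \<phi>1" "class_Kinf \<phi>2"
    and \<rho>: "0 \<le> \<rho>" "\<rho> < 1"
    and V_nonneg: "\<And>x. 0 \<le> V x"
    and V_bounds: "\<And>x. \<phi>1 (norm x) \<le> V x \<and> V x \<le> \<phi>2 (norm x)"
    and V_\<kappa>: "\<And>x. V (f (x, \<kappa> x, 0)) \<le> \<rho> * V x"
    and V_\<mu>: "\<And>x. V (f (x, \<mu> x, 0)) \<le> \<rho> * V x"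
    and N_range: "\<And>k \<omega>. \<omega> \<in> space M \<Longrightarrow> N k \<omega> \<le> \<Lambda>"
    and N_indep: "prob_space.indep_vars M (\<lambda>_. count_space UNIV) N UNIV"
    and N_law: "\<And>k l. l \<le> \<Lambda> \<Longrightarrow> measure M {\<omega> \<in> space M. N k \<omega> = l} = p l"
    and p0: "0 \<le> p 0" "p 0 < 1"
    and x0_meas: "x0 \<in> borel_measurable M"
    and x0_indep: "prob_space.indep_set M
          (sets (vimage_algebra (space M) x0 borel))
          (sets (vimage_algebra (space M) (\<lambda>\<omega> k. N k \<omega>) (Pi\<^sub>M UNIV (\<lambda>_. count_space UNIV))))"
    and P: "P = uniform_measure M {\<omega> \<in> space M. N 0 \<omega> > 0}"
    and \<alpha>: "1 \<le> \<alpha>" "p 0 > 0 \<Longrightarrow> \<alpha> < 1 / p 0"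
    and V_open: "\<And>x. V (f (x, 0, 0)) \<le> \<alpha> * V x"
    and x0_moment: "(\<integral>\<^sup>+\<omega>. ennreal (\<phi>2 (norm (x0 \<omega>))) \<partial>P) < \<infinity>"
    and \<sigma>: "\<sigma> = 1 / (1 - p 0 * \<rho>) *
               (\<rho> * (1 - p 0 * \<alpha>) + (\<alpha> - \<rho>) / (1 - p 0) * (\<Sum>l=1..\<Lambda>. p l * (p 0 * \<rho>) ^ l))"
    and contraction: "p 0 * \<alpha> + (1 - p 0) * \<sigma> < 1"
  shows "stochastically_stable P (\<lambda>k \<omega>. state_trajectory f \<mu> \<Lambda> (\<lambda>i. N i \<omega>) (x0 \<omega>) k)"
proof -
  interpret prob_space M by (rule M)
  have par: "dropout_parameters (p 0) \<rho> \<alpha>"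
  proof
    show "p 0 * \<alpha> < 1"
      using \<alpha>(2) p0 by (cases "p 0 = 0") (auto simp: field_simps)
  qed (use p0 \<rho> \<alpha>(1) in auto)
  interpret dropout_parameters "p 0" \<rho> \<alpha> by (rule par)
  have [measurable]: "N i \<in> measurable M (count_space UNIV)" for i
    using N_indep by (simp add: indep_vars_def)
  have N_path: "(\<lambda>\<omega> i. N i \<omega>) \<in> measurable M (Pi\<^sub>M UNIV (\<lambda>_. count_space UNIV))"
    by (rule measurable_PiM_single') auto
  note [measurable] = x0_meas V_meas
  \<comment> \<open>averaging the constant \<open>1\<close> over the law of a count shows that the weights sum to \<open>1\<close>\<close>
  have "1 = (\<Sum>l\<le>\<Lambda>. p l)"
    using expectation_fresh[OF N_indep N_range, where \<Phi> = "\<lambda>_ _. 1" and B = 1 and k = 0]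
    by (simp add: N_law prob_space)
  moreover have "{..\<Lambda>} = insert 0 {1..\<Lambda>}" by auto
  ultimately have "(\<Sum>l=1..\<Lambda>. p l) = 1 - p 0" by simp
  note refill = refill_sum[OF this \<sigma>]
  define \<delta> where "\<delta> = 1 - (\<Sum>l=1..\<Lambda>. p l * (\<rho> * potential (p 0) \<rho> \<alpha> l))"
  have \<delta>_pos: "0 < \<delta>"
    unfolding \<delta>_def refill using contraction par[unfolded dropout_parameters_def] by (simp add: field_simps)

  define A where "A = {\<omega> \<in> space M. N 0 \<omega> > 0}"
  have A [measurable]: "A \<in> sets M" unfolding A_def by measurable
  have "A = space M - {\<omega> \<in> space M. N 0 \<omega> = 0}" by (auto simp: A_def)
  then have prob_A: "prob A = 1 - p 0"
    using N_law[of 0 0] by (simp add: prob_compl)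
  have A_pos: "emeasure M A \<noteq> 0" "emeasure M A \<noteq> \<infinity>"
    using prob_A p0 by (auto simp: emeasure_eq_measure)

  have split: "(\<integral>\<^sup>+\<omega>. ennreal (V (x0 \<omega>)) * h (\<lambda>i. N i \<omega>) \<partial>M) =
      (\<integral>\<^sup>+\<omega>. ennreal (V (x0 \<omega>)) \<partial>M) * (\<integral>\<^sup>+\<omega>. h (\<lambda>i. N i \<omega>) \<partial>M)"
    if "h \<in> borel_measurable (Pi\<^sub>M UNIV (\<lambda>_. count_space UNIV))" for h
    by (intro nn_integral_indep_var_mult indep_var_of_indep_vimage_algebras[OF x0_indep x0_meas N_path _ that]) measurable

  \<comment> \<open>the moment condition is conditional on \<open>A\<close>, but by independence \<open>A\<close> does not affect
    the law of the initial state, so the unconditional moment of \<open>V\<close> is finite as well\<close>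
  define E where "E = (\<integral>\<^sup>+\<omega>. ennreal (V (x0 \<omega>)) \<partial>M)"
  have E_finite: "E < \<infinity>"
  proof -
    have E_A: "E * emeasure M A = (\<integral>\<^sup>+\<omega>. ennreal (V (x0 \<omega>)) * indicator A \<omega> \<partial>M)"
    proof -
      have "(\<integral>\<^sup>+\<omega>. ennreal (V (x0 \<omega>)) * indicator A \<omega> \<partial>M) =
          (\<integral>\<^sup>+\<omega>. ennreal (V (x0 \<omega>)) * indicator {0<..} (N 0 \<omega>) \<partial>M)"
        by (intro nn_integral_cong) (auto simp: A_def indicator_def)
      also have "\<dots> = E * (\<integral>\<^sup>+\<omega>. indicator {0<..} (N 0 \<omega>) \<partial>M)"
        unfolding E_def
        by (rule split[of "\<lambda>ns. indicator {0<..} (ns 0)"], rule measurable_compose[OF measurable_component_singleton]) auto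
      also have "(\<integral>\<^sup>+\<omega>. indicator {0<..} (N 0 \<omega>) \<partial>M) = (\<integral>\<^sup>+\<omega>. indicator A \<omega> \<partial>M)"
        by (intro nn_integral_cong) (auto simp: A_def indicator_def)
      finally show ?thesis by simp
    qed
    have "E = E * emeasure M A / emeasure M A"
      using A_pos by (simp add: mult_divide_eq_ennreal)
    also have "\<dots> = (\<integral>\<^sup>+\<omega>. ennreal (V (x0 \<omega>)) \<partial>P)"
      by (simp add: E_A P A_def[symmetric] nn_integral_uniform_measure)
    also have "\<dots> \<le> (\<integral>\<^sup>+\<omega>. ennreal (\<phi>2 (norm (x0 \<omega>))) \<partial>P)"
      using V_bounds by (intro nn_integral_mono ennreal_leI) auto
    finally show ?thesis using x0_moment by (rule le_less_trans)
  qed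

  define w where "w k = expectation (\<lambda>\<omega>. growth \<rho> \<alpha> (\<lambda>i. N i \<omega>) k)" for k
  have growth_meas: "(\<lambda>ns. growth \<rho> \<alpha> ns k) \<in> borel_measurable (Pi\<^sub>M UNIV (\<lambda>_. count_space UNIV))" for k
    by (rule measurable_finitely_dependent[where k = k]) (auto intro: growth_cong)
  have w: "(\<integral>\<^sup>+\<omega>. ennreal (growth \<rho> \<alpha> (\<lambda>i. N i \<omega>) k) \<partial>M) = ennreal (w k)" for k
    unfolding w_def using growth_bounds[OF \<rho> \<alpha>(1)]
    by (intro nn_integral_eq_integral integrable_const_bound[where B = "\<alpha> ^ k"]
        measurable_compose[OF N_path growth_meas]) auto
  have step: "(\<integral>\<^sup>+\<omega>. ennreal (\<phi>1 (norm (state_trajectory f \<mu> \<Lambda> (\<lambda>i. N i \<omega>) (x0 \<omega>) k))) \<partial>P)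
      \<le> ennreal (w k) * (E / emeasure M A)" for k
  proof -
    have [measurable]: "(\<lambda>\<omega>. growth \<rho> \<alpha> (\<lambda>i. N i \<omega>) k) \<in> borel_measurable M"
      by (rule measurable_compose[OF N_path growth_meas])
    have "(\<integral>\<^sup>+\<omega>. ennreal (\<phi>1 (norm (state_trajectory f \<mu> \<Lambda> (\<lambda>i. N i \<omega>) (x0 \<omega>) k))) \<partial>P)
        \<le> (\<integral>\<^sup>+\<omega>. ennreal (V (x0 \<omega>)) * ennreal (growth \<rho> \<alpha> (\<lambda>i. N i \<omega>) k) \<partial>P)"
    proof (intro nn_integral_mono)
      fix \<omega> assume "\<omega> \<in> space P"
      then have "N i \<omega> \<le> \<Lambda>" for i using N_range by (simp add: P)
      then have "V (state_trajectory f \<mu> \<Lambda> (\<lambda>i. N i \<omega>) (x0 \<omega>) k) \<le> growth \<rho> \<alpha> (\<lambda>i. N i \<omega>) k * V (x0 \<omega>)"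
        using buffer_size \<rho> \<alpha> V_\<mu> V_open by (intro Lyapunov_state_trajectory_le) auto
      then show "ennreal (\<phi>1 (norm (state_trajectory f \<mu> \<Lambda> (\<lambda>i. N i \<omega>) (x0 \<omega>) k)))
          \<le> ennreal (V (x0 \<omega>)) * ennreal (growth \<rho> \<alpha> (\<lambda>i. N i \<omega>) k)"
        using V_bounds[of "state_trajectory f \<mu> \<Lambda> (\<lambda>i. N i \<omega>) (x0 \<omega>) k"]
          growth_bounds(1)[OF \<rho> \<alpha>(1)] V_nonneg
        by (subst ennreal_mult[symmetric]) (auto intro!: ennreal_leI simp: mult.commute intro: order_trans)
    qed
    also have "\<dots> = (\<integral>\<^sup>+\<omega>. ennreal (V (x0 \<omega>)) * ennreal (growth \<rho> \<alpha> (\<lambda>i. N i \<omega>) k) * indicator A \<omega> \<partial>M) / emeasure M A"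
      unfolding P A_def[symmetric] by (rule nn_integral_uniform_measure) measurable
    also have "\<dots> \<le> (\<integral>\<^sup>+\<omega>. ennreal (V (x0 \<omega>)) * ennreal (growth \<rho> \<alpha> (\<lambda>i. N i \<omega>) k) \<partial>M) / emeasure M A"
      by (intro divide_right_mono_ennreal nn_integral_mono) (auto simp: indicator_def)
    also have "\<dots> = ennreal (w k) * (E / emeasure M A)"
      using split[OF measurable_compose[OF growth_meas measurable_ennreal], of k] w[of k]
      by (simp add: E_def ennreal_times_divide mult.commute)
    finally show ?thesis .
  qed

  have "(\<Sum>k. \<integral>\<^sup>+\<omega>. ennreal (\<phi>1 (norm (state_trajectory f \<mu> \<Lambda> (\<lambda>i. N i \<omega>) (x0 \<omega>) k))) \<partial>P)
      \<le> (\<Sum>k. ennreal (w k) * (E / emeasure M A))"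
    by (intro suminf_le summableI step)
  also have "\<dots> = (\<Sum>k. ennreal (w k)) * (E / emeasure M A)"
    by (rule ennreal_suminf_multc)
  also have "\<dots> \<le> ennreal (potential (p 0) \<rho> \<alpha> 0 / \<delta>) * (E / emeasure M A)"
  proof (intro mult_right_mono suminf_le_const summableI)
    fix n
    have "0 \<le> w k" for k
      unfolding w_def using growth_bounds(1)[OF \<rho> \<alpha>(1)] by (intro integral_nonneg_AE) auto
    then show "(\<Sum>k<n. ennreal (w k)) \<le> ennreal (potential (p 0) \<rho> \<alpha> 0 / \<delta>)"
      using sum_expectation_growth_le[OF par N_indep N_range N_law \<delta>_def \<delta>_pos, of n]
      by (simp add: sum_ennreal w_def ennreal_leI)
  qed simp
  also have "\<dots> < \<infinity>"
  proof -
    have "E / emeasure M A \<noteq> top"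
      using E_finite A_pos by (auto simp: ennreal_divide_eq_top_iff)
    then show ?thesis by (simp add: ennreal_mult_less_top less_top)
  qed
  finally show ?thesis
    unfolding stochastically_stable_def using Kinf(1) by blast
qed

end
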